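(* There exist families $\mathcal{F}_3$, $\mathcal{F}_4$ and $\mathcal{F}_5$, each consisting of $2^{\mathfrak{c}}$ many pairwise non-isomorphic free filters on $\omega$, such that: (a) for every $F\in\mathcal{F}_3$ the space $N_F$ has the Josefson--Nissenzweig property (JNP); (b) for every $F\in\mathcal{F}_4$ the space $N_F$ has the bounded Josefson--Nissenzweig property (BJNP) but does not have the JNP; (c) for every $F\in\mathcal{F}_5$ the space $N_F$ does not have the BJNP.
   Context: $\mathfrak{c}$ is the cardinality of $\mathbb{R}$. A filter $F$ on $\omega$ is free if $\bigcap F=\emptyset$ (equivalently, $F$ contains every cofinite set); filters are proper. Filters $F,G$ on $\omega$ are isomorphic if there is a bijection $f:\omega\to\omega$ with $F=\{A\subseteq\omega: f^{-1}[A]\in G\}$. For a free filter $F$ on $\omega$, $N_F=\omega\cup\{p_F\}$, $p_F\notin\omega$, with the topology in which every point of $\omega$ is isolated and the open neighborhoods of $p_F$ are exactly the sets $A\cup\{p_F\}$ with $A\in F$. A finitely supported measure on a Tychonoff space $X$ is $\mu=\sum_{i=1}^n\alpha_i\delta_{x_i}$ with distinct $x_i\in X$ and $\alpha_i\in\mathbb{R}\setminus\{0\}$; $\|\mu\|=\sum_i|\alpha_i|$, $\mu(f)=\sum_i\alpha_i f(x_i)$. $X$ has the JNP (resp. the BJNP) if there is a sequence $\langle\mu_n: n\in\omega\rangle$ of finitely supported measures on $X$ with $\|\mu_n\|=1$ for all $n$ and $\mu_n(f)\to0$ for every continuous (resp. bounded continuous) $f:X\to\mathbb{R}$. *)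

theory Defs
  imports "HOL-Analysis.Analysis" "HOL-Library.Equipollence" "HOL-Library.Poly_Mapping"
begin

text \<open>
  A filter on \<open>\<omega>\<close> is a \<^typ>\<open>nat filter\<close>, whose member sets are the \<open>A\<close> with
  \<open>eventually (\<lambda>n. n \<in> A) F\<close>.  The library type also contains the improper filter \<open>bot\<close>,
  so properness is required separately.
\<close>

definition free_filter :: "nat filter \<Rightarrow> bool" where
  "free_filter F \<longleftrightarrow> F \<noteq> bot \<and> \<Inter> {A. eventually (\<lambda>n. n \<in> A) F} = {}"

text \<open>\<open>A\<close> is a member of \<open>filtermap f G\<close> iff its preimage \<open>f -` A\<close> is a member of \<open>G\<close>.\<close>

definition filter_isomorphic :: "nat filter \<Rightarrow> nat filter \<Rightarrow> bool" where
  "filter_isomorphic F G \<longleftrightarrow> (\<exists>f. bij f \<and> F = filtermap f G)"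

text \<open>The space \<open>N\<^sub>F\<close>: the isolated points are the \<open>Some n\<close>, and \<open>None\<close> is the point \<open>p\<^sub>F\<close>.\<close>

definition N_space :: "nat filter \<Rightarrow> nat option topology" where
  "N_space F = topology (\<lambda>U. None \<in> U \<longrightarrow> eventually (\<lambda>n. Some n \<in> U) F)"

lemma openin_N_space:
  "openin (N_space F) U \<longleftrightarrow> (None \<in> U \<longrightarrow> eventually (\<lambda>n. Some n \<in> U) F)"
proof -
  have "istopology (\<lambda>U. None \<in> U \<longrightarrow> eventually (\<lambda>n. Some n \<in> U) F)"
    unfolding istopology_def
  proof (intro conjI allI impI)
    fix S T :: "nat option set"
    assume "None \<in> S \<longrightarrow> eventually (\<lambda>n. Some n \<in> S) F"
      and "None \<in> T \<longrightarrow> eventually (\<lambda>n. Some n \<in> T) F" and "None \<in> S \<inter> T"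
    then show "eventually (\<lambda>n. Some n \<in> S \<inter> T) F"
      by (simp add: eventually_conj)
  next
    fix K :: "nat option set set"
    assume K: "\<forall>S\<in>K. None \<in> S \<longrightarrow> eventually (\<lambda>n. Some n \<in> S) F" and "None \<in> \<Union>K"
    then obtain S where "S \<in> K" "eventually (\<lambda>n. Some n \<in> S) F"
      by blast
    then show "eventually (\<lambda>n. Some n \<in> \<Union>K) F"
      by (auto elim!: eventually_mono)
  qed
  then show ?thesis
    unfolding N_space_def by (simp add: topology_inverse')
qed

lemma topspace_N_space [simp]: "topspace (N_space F) = UNIV"
proof -
  have "openin (N_space F) UNIV"
    by (simp add: openin_N_space)
  then show ?thesis
    using openin_subset by blast
qed

lemma openin_N_space_None_iff:
  "openin (N_space F) U \<and> None \<in> U \<longleftrightarrow>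
     (\<exists>A. eventually (\<lambda>n. n \<in> A) F \<and> U = insert None (Some ` A))"
proof
  assume U: "openin (N_space F) U \<and> None \<in> U"
  have "x \<in> U \<longleftrightarrow> x \<in> insert None (Some ` {n. Some n \<in> U})" for x
    using U by (cases x) auto
  then have "U = insert None (Some ` {n. Some n \<in> U})"
    by blast
  then show "\<exists>A. eventually (\<lambda>n. n \<in> A) F \<and> U = insert None (Some ` A)"
    using U by (intro exI[of _ "{n. Some n \<in> U}"]) (auto simp: openin_N_space)
next
  assume "\<exists>A. eventually (\<lambda>n. n \<in> A) F \<and> U = insert None (Some ` A)"
  then show "openin (N_space F) U \<and> None \<in> U"
    by (auto simp: openin_N_space image_iff)
qed

text \<open>
  The finitely supported measure \<open>\<Sum>\<^sub>i \<alpha>\<^sub>i \<delta>\<^bsub>x\<^sub>i\<^esub>\<close> is the finitely supported function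
  mapping each \<open>x\<^sub>i\<close> to \<open>\<alpha>\<^sub>i\<close>; its \<open>keys\<close> are the points \<open>x\<^sub>i\<close>.
\<close>

definition fs_measure_on :: "'a topology \<Rightarrow> ('a \<Rightarrow>\<^sub>0 real) \<Rightarrow> bool" where
  "fs_measure_on X \<mu> \<longleftrightarrow> Poly_Mapping.keys \<mu> \<subseteq> topspace X"

definition fs_norm :: "('a \<Rightarrow>\<^sub>0 real) \<Rightarrow> real" where
  "fs_norm \<mu> = (\<Sum>x\<in>Poly_Mapping.keys \<mu>. \<bar>Poly_Mapping.lookup \<mu> x\<bar>)"

definition fs_integral :: "('a \<Rightarrow>\<^sub>0 real) \<Rightarrow> ('a \<Rightarrow> real) \<Rightarrow> real" where
  "fs_integral \<mu> f = (\<Sum>x\<in>Poly_Mapping.keys \<mu>. Poly_Mapping.lookup \<mu> x * f x)"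

definition JNP :: "'a topology \<Rightarrow> bool" where
  "JNP X \<longleftrightarrow> (\<exists>\<mu> :: nat \<Rightarrow> 'a \<Rightarrow>\<^sub>0 real.
     (\<forall>n. fs_measure_on X (\<mu> n) \<and> fs_norm (\<mu> n) = 1) \<and>
     (\<forall>f. continuous_map X euclideanreal f \<longrightarrow> (\<lambda>n. fs_integral (\<mu> n) f) \<longlonglongrightarrow> 0))"

definition BJNP :: "'a topology \<Rightarrow> bool" where
  "BJNP X \<longleftrightarrow> (\<exists>\<mu> :: nat \<Rightarrow> 'a \<Rightarrow>\<^sub>0 real.
     (\<forall>n. fs_measure_on X (\<mu> n) \<and> fs_norm (\<mu> n) = 1) \<and>
     (\<forall>f. continuous_map X euclideanreal f \<and> bounded (f ` topspace X) \<longrightarrow>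
        (\<lambda>n. fs_integral (\<mu> n) f) \<longlonglongrightarrow> 0))"

end

theory Submission
  imports Defs
begin

text \<open>
  Let \<open>U\<close> be a free ultrafilter.  A sequence of norm-one measures on \<open>N\<^sub>U\<close> that is null on bounded
  continuous functions has, along a subsequence, humps on pairwise disjoint finite sets.  The union
  of the even humps or the union of the odd humps lies outside \<open>U\<close>, so the signs on that union
  extend by \<open>0\<close> to a continuous function, which contradicts nullity; hence \<open>N\<^sub>U\<close> fails the BJNP.

  If every infinite set contains an infinite set whose complement belongs to \<open>F\<close>, then one point from
  each hump can be chosen so that an arbitrary, possibly unbounded, function on these points extends
  by \<open>0\<close> continuously; hence \<open>N\<^sub>F\<close> fails the JNP.

  Copy \<open>U\<close> onto the odd numbers and put a filter \<open>G\<close> on the even numbers.  If \<open>G\<close> is the cofinite filter,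
  then \<open>N\<^sub>F\<close> has a nontrivial convergent sequence and so the JNP.  If \<open>G\<close> consists of the sets of
  density \<open>1\<close> with respect to finite blocks of growing size, then the uniform measures on the blocks
  minus \<open>\<delta>\<close> at \<open>p\<^sub>F\<close> witness the BJNP, while the previous criterion excludes the JNP.  Letting \<open>U\<close> range over
  the \<open>2\<^sup>\<cc>\<close> free ultrafilters gives the three families.
\<close>

section \<open>Isomorphism classes of filters\<close>

lemma filter_isomorphic_sym:
  assumes "filter_isomorphic F G"
  shows "filter_isomorphic G F"
proof -
  obtain f where f: "bij f" "F = filtermap f G"
    using assms unfolding filter_isomorphic_def by blast
  then have "G = filtermap (inv f) F"
    by (simp add: filtermap_filtermap bij_is_inj inv_f_f)
  then show ?thesis
    unfolding filter_isomorphic_def using bij_imp_bij_inv[OF f(1)] by blast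
qed

lemma filter_isomorphic_trans:
  assumes "filter_isomorphic F G" "filter_isomorphic G H"
  shows "filter_isomorphic F H"
proof -
  obtain f g where "bij f" "F = filtermap f G" "bij g" "G = filtermap g H"
    using assms unfolding filter_isomorphic_def by blast
  then have "bij (f \<circ> g)" "F = filtermap (f \<circ> g) H"
    using bij_comp by (auto simp only: filtermap_filtermap comp_def)
  then show ?thesis
    unfolding filter_isomorphic_def by blast
qed

lemma filter_isomorphic_refl: "filter_isomorphic F F"
  unfolding filter_isomorphic_def by (rule exI[of _ id]) (simp add: filtermap_ident id_def[symmetric])

text \<open>A function is coded by its graph, a set of naturals. This bounds the number of
  bijections, hence the size of an isomorphism class.\<close>

lemma nat_functions_lepoll_reals: "(UNIV :: (nat \<Rightarrow> nat) set) \<lesssim> (UNIV :: real set)"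
proof -
  have "inj (\<lambda>f :: nat \<Rightarrow> nat. range (\<lambda>n. prod_encode (n, f n)))"
    by (rule injI) (force simp: set_eq_iff image_iff)
  then have "(UNIV :: (nat \<Rightarrow> nat) set) \<lesssim> (UNIV :: nat set set)"
    unfolding lepoll_def by blast
  then show ?thesis
    using nat_sets_eqpoll_reals lepoll_trans2 by blast
qed

text \<open>An isomorphism class has at most continuum many members, so \<open>2\<^sup>\<cc>\<close> many filters
  meet \<open>2\<^sup>\<cc>\<close> many classes.\<close>

lemma eqpoll_many_nonisomorphic:
  fixes \<Phi> :: "real set \<Rightarrow> nat filter"
  assumes "inj \<Phi>"
  obtains R where "R \<subseteq> range \<Phi>" "R \<approx> (UNIV :: real set set)"
    "pairwise (\<lambda>F G. \<not> filter_isomorphic F G) R"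
proof
  include cardinal_syntax
  \<comment> \<open>Isomorphic filters satisfy the same predicate, so \<open>SOME\<close> returns
    one representative per class and \<open>R\<close> is a transversal of the classes meeting
    \<open>range \<Phi>\<close>.\<close>
  define rep where "rep F = (SOME G. G \<in> range \<Phi> \<and> filter_isomorphic F G)" for F
  define R where "R = rep ` range \<Phi>"
  have rep: "rep F \<in> range \<Phi>" "filter_isomorphic F (rep F)" if "F \<in> range \<Phi>" for F
    using someI[of "\<lambda>G. G \<in> range \<Phi> \<and> filter_isomorphic F G" F] that filter_isomorphic_refl
    unfolding rep_def by auto
  have rep_eq: "rep F = rep G" if "filter_isomorphic F G" for F G
    using that filter_isomorphic_sym filter_isomorphic_trans unfolding rep_def by metis
  show sub: "R \<subseteq> range \<Phi>"
    using rep unfolding R_def by blast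
  show "pairwise (\<lambda>F G. \<not> filter_isomorphic F G) R"
  proof (rule pairwiseI, rule notI)
    fix F G assume FG: "F \<in> R" "G \<in> R" "F \<noteq> G" "filter_isomorphic F G"
    have "rep H = H" if "H \<in> R" for H
      using that rep rep_eq filter_isomorphic_sym unfolding R_def by (metis imageE)
    then show False
      using rep_eq FG by metis
  qed
  have cover: "range \<Phi> \<subseteq> (\<Union>F\<in>R. range (\<lambda>f. filtermap f F))"
  proof
    fix F assume F: "F \<in> range \<Phi>"
    then obtain f where "F = filtermap f (rep F)"
      using rep(2) unfolding filter_isomorphic_def by blast
    then show "F \<in> (\<Union>F\<in>R. range (\<lambda>f. filtermap f F))"
      using F unfolding R_def by blast
  qed
  have iso_class: "|range (\<lambda>f :: nat \<Rightarrow> nat. filtermap f F)| \<le>o |UNIV :: real set|" for F :: "nat filter"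
    using lepoll_trans[OF image_lepoll nat_functions_lepoll_reals]
    unfolding lepoll_def card_of_ordLeq by blast
  have "|UNIV :: real set set| \<le>o |R|"
  proof (rule ccontr)
    assume "\<not> |UNIV :: real set set| \<le>o |R|"
    then have R_less: "|R| <o |UNIV :: real set set|"
      by (meson card_of_Well_order not_ordLeq_iff_ordLess)
    have real_less: "|UNIV :: real set| <o |UNIV :: real set set|"
      by (metis card_of_Pow Pow_UNIV)
    \<comment> \<open>By \<open>cover\<close>, \<open>range \<Phi>\<close> is covered by |R| many
      sets of size at most continuum. \<open>B\<close> will be the larger of \<open>R\<close> and
      the reals, and both are smaller than \<open>real set set\<close>.\<close>
    have union: "|range \<Phi>| \<le>o |B|"
      if "infinite B" "|R| \<le>o |B|" "|UNIV :: real set| \<le>o |B|" for B :: "'b set"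
      using card_of_UNION_ordLeq_infinite[OF that(1,2)] iso_class that(3) ordLeq_transitive
        card_of_mono1[OF cover] by metis
    have "|range \<Phi>| <o |UNIV :: real set set|"
    proof (cases "|R| \<le>o |UNIV :: real set|")
      case True
      then show ?thesis
        using union[of "UNIV :: real set"] real_less ordLeq_ordLess_trans
        by (metis card_of_refl infinite_UNIV_char_0 ordIso_imp_ordLeq)
    next
      case False
      then have "|UNIV :: real set| \<le>o |R|"
        by (meson card_of_Well_order not_ordLeq_iff_ordLess ordLess_imp_ordLeq)
      then have "infinite R"
        using card_of_ordLeq_infinite infinite_UNIV_char_0 by blast
      then show ?thesis
        using union[of R] \<open>|UNIV :: real set| \<le>o |R|\<close> R_less ordLeq_ordLess_trans
        by (metis card_of_refl ordIso_imp_ordLeq)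
    qed
    moreover have "|UNIV :: real set set| \<le>o |range \<Phi>|"
      using assms card_of_ordLeq by blast
    ultimately show False
      using not_ordLess_ordLeq by blast
  qed
  moreover have "R \<lesssim> (UNIV :: real set set)"
    using sub subset_image_lepoll by blast
  ultimately show "R \<approx> (UNIV :: real set set)"
    by (simp only: lepoll_antisym lepoll_def card_of_ordLeq)
qed

section \<open>Free ultrafilters\<close>

definition ultrafilter :: "'a filter \<Rightarrow> bool" where
  "ultrafilter F \<longleftrightarrow> F \<noteq> bot \<and> (\<forall>P. eventually P F \<or> eventually (\<lambda>x. \<not> P x) F)"

text \<open>Zorn's lemma with the order reversed: in the library order a finer filter is smaller, so
  ultrafilters are the minimal proper filters.\<close>

lemma ultrafilter_exists:
  assumes "F \<noteq> bot"
  obtains U where "ultrafilter U" "U \<le> F"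
proof -
  let ?A = "{G. G \<noteq> bot \<and> G \<le> F}"
  have "\<exists>m\<in>?A. \<forall>a\<in>?A. m \<ge> a \<longrightarrow> a = m"
  proof (rule predicate_Zorn)
    show "partial_order_on ?A (relation_of (\<ge>) ?A)"
      by (rule partial_order_on_relation_ofI) auto
    fix C assume C: "C \<in> Chains (relation_of (\<ge>) ?A)"
    show "\<exists>u\<in>?A. \<forall>a\<in>C. u \<le> a"
    proof (cases "C = {}")
      case True
      then show ?thesis
        using assms by auto
    next
      case False
      have rel: "(G, H) \<in> relation_of (\<ge>) ?A \<or> (H, G) \<in> relation_of (\<ge>) ?A"
        if "G \<in> C" "H \<in> C" for G H
        using C that unfolding Chains_def by blast
      have C_sub: "G \<noteq> bot" "G \<le> F" if "G \<in> C" for G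
        using rel[OF that that] unfolding relation_of_def by simp_all
      have lin: "G \<le> H \<or> H \<le> G" if "G \<in> C" "H \<in> C" for G H
        using rel[OF that] unfolding relation_of_def by blast
      \<comment> \<open>A chain is directed downwards, so it is a base of its infimum, which
        therefore inherits properness.\<close>
      have "\<exists>K\<in>C. K \<le> inf G H" if "G \<in> C" "H \<in> C" for G H
        using lin[OF that] that by (auto intro: bexI[of _ G] bexI[of _ H])
      then have "eventually P (Inf C) \<longleftrightarrow> (\<exists>G\<in>C. eventually P G)" for P
        using False eventually_Inf_base by blast
      then have "Inf C \<noteq> bot"
        using C_sub(1) False unfolding trivial_limit_def by blast
      moreover have "Inf C \<le> F"
        using False C_sub(2) by (meson Inf_lower2 all_not_in_conv)
      ultimately show ?thesis
        by (intro bexI[of _ "Inf C"] ballI Inf_lower) simp_all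
    qed
  qed
  then obtain U where U: "U \<noteq> bot" "U \<le> F" and min: "\<And>G. G \<noteq> bot \<Longrightarrow> G \<le> U \<Longrightarrow> G = U"
    by (metis (mono_tags, lifting) mem_Collect_eq order_trans)
  \<comment> \<open>If adding \<open>P\<close> to \<open>U\<close> keeps it proper, minimality shows
    that \<open>P\<close> already holds eventually; otherwise its negation does.\<close>
  have "eventually P U \<or> eventually (\<lambda>x. \<not> P x) U" for P
  proof (cases "inf U (principal {x. P x}) = bot")
    case True
    then show ?thesis
      unfolding trivial_limit_def eventually_inf_principal by simp
  next
    case False
    then have "U \<le> principal {x. P x}"
      using min[of "inf U (principal {x. P x})"] by (metis inf_le1 inf_le2)
    then show ?thesis
      by (simp add: le_principal)
  qed
  then show thesis
    using U that unfolding ultrafilter_def by blast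
qed

lemma free_filter_iff_le_cofinite: "free_filter F \<longleftrightarrow> F \<noteq> bot \<and> F \<le> cofinite"
proof -
  have "\<Inter> {A. eventually (\<lambda>n. n \<in> A) F} = {} \<longleftrightarrow> (\<forall>n. eventually (\<lambda>m. m \<noteq> n) F)" (is "?L \<longleftrightarrow> ?R")
  proof
    assume L: ?L
    show ?R
    proof
      fix n
      obtain A where "eventually (\<lambda>m. m \<in> A) F" "n \<notin> A"
        using L by blast
      then show "eventually (\<lambda>m. m \<noteq> n) F"
        by (auto elim: eventually_mono)
    qed
  next
    assume R: ?R
    have "n \<notin> \<Inter> {A. eventually (\<lambda>n. n \<in> A) F}" for n
      using R[rule_format, of n] by (auto intro!: exI[of _ "- {n}"])
    then show ?L
      by blast
  qed
  also have "?R \<longleftrightarrow> F \<le> cofinite"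
  proof
    assume R: ?R
    show "F \<le> cofinite"
    proof (rule filter_leI)
      fix P :: "nat \<Rightarrow> bool"
      assume "eventually P cofinite"
      then have "finite {n. \<not> P n}"
        by (simp add: eventually_cofinite)
      then have "eventually (\<lambda>m. \<forall>n\<in>{n. \<not> P n}. m \<noteq> n) F"
        using R by (intro eventually_ball_finite) auto
      then show "eventually P F"
        by (auto elim: eventually_mono)
    qed
  next
    assume "F \<le> cofinite"
    then show ?R
      by (auto simp: le_filter_def eventually_cofinite)
  qed
  finally show ?thesis
    unfolding free_filter_def by blast
qed

text \<open>The classical independent family on the countable set of pairs of a length \<open>n\<close> and a finite
  list of initial segments of that length.\<close>

definition independent_set :: "nat set \<Rightarrow> nat set" where
  "independent_set X = {m. case from_nat m of (n :: nat, L :: nat list list) \<Rightarrow>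
     filter (\<lambda>i. i \<in> X) [0..<n] \<in> set L}"

text \<open>Finitely many distinct sets have distinct traces on every sufficiently long initial
  segment, and each such length contributes its own point to the intersection.\<close>

lemma infinite_Int_independent_sets:
  assumes "finite \<X>"
  shows "infinite (\<Inter>X\<in>\<X>. if X \<in> \<S> then independent_set X else - independent_set X)"
proof -
  let ?w = "\<lambda>n X. filter (\<lambda>i. i \<in> X) [0..<n]"
  \<comment> \<open>\<open>d X Y\<close> is the first place where \<open>X\<close> and
    \<open>Y\<close> differ, and \<open>N\<close> exceeds all of them; \<open>insert 0\<close>
    covers an empty \<open>\<X>\<close>.\<close>
  define d where "d X Y = (LEAST i. i \<in> X \<longleftrightarrow> i \<notin> Y)" for X Y :: "nat set"
  define N where "N = Suc (Max (insert 0 ((\<lambda>(X, Y). d X Y) ` (\<X> \<times> \<X>))))"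
  obtain Ls where Ls: "set Ls = \<X> \<inter> \<S>"
    using assms finite_list by (metis finite_Int)
  have separated: "?w n X \<noteq> ?w n Y" if "X \<in> \<X>" "Y \<in> \<X>" "X \<noteq> Y" "N \<le> n" for X Y n
  proof
    assume eq: "?w n X = ?w n Y"
    have "d X Y \<le> Max (insert 0 ((\<lambda>(X, Y). d X Y) ` (\<X> \<times> \<X>)))"
      using assms that by (intro Max_ge) auto
    then have "d X Y < n"
      using \<open>N \<le> n\<close> unfolding N_def by simp
    moreover have "d X Y \<in> X \<longleftrightarrow> d X Y \<notin> Y"
      unfolding d_def by (rule LeastI_ex) (use \<open>X \<noteq> Y\<close> in blast)
    moreover have "i \<in> set (?w n Z) \<longleftrightarrow> i < n \<and> i \<in> Z" for i Z
      by auto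
    ultimately show False
      using eq by metis
  qed
  \<comment> \<open>This point lists exactly the traces of the members of \<open>\<X>\<close> in
    \<open>\<S>\<close>; separation keeps the traces of the other members off the list.\<close>
  let ?m = "\<lambda>n. to_nat (n, map (?w n) Ls)"
  have "?m n \<in> (\<Inter>X\<in>\<X>. if X \<in> \<S> then independent_set X else - independent_set X)"
    if "N \<le> n" for n
  proof -
    have "?m n \<in> independent_set X \<longleftrightarrow> X \<in> \<S>" if "X \<in> \<X>" for X
      using separated[OF that _ _ \<open>N \<le> n\<close>] Ls that
      by (auto simp: independent_set_def image_iff)
    then show ?thesis
      by auto
  qed
  then have "?m ` {N..} \<subseteq> (\<Inter>X\<in>\<X>. if X \<in> \<S> then independent_set X else - independent_set X)"
    by (intro image_subsetI) (simp only: atLeast_iff)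
  moreover have "inj_on ?m {N..}"
    by (auto intro: inj_onI)
  then have "infinite (?m ` {N..})"
    using finite_imageD infinite_Ici by blast
  ultimately show ?thesis
    using finite_subset by blast
qed

text \<open>Each \<open>\<S>\<close> prescribes which independent sets belong to the ultrafilter.
  Any finite part of a prescription leaves an infinite set, so it is compatible with
  freeness.\<close>

lemma ex_inj_free_ultrafilters:
  obtains \<Phi> :: "nat set set \<Rightarrow> nat filter"
  where "inj \<Phi>" "\<And>\<S>. ultrafilter (\<Phi> \<S>)" "\<And>\<S>. \<Phi> \<S> \<le> cofinite"
proof -
  define A where "A \<S> X = (if X \<in> \<S> then independent_set X else - independent_set X)"
    for \<S> :: "nat set set" and X
  define F where "F \<S> = (INF X. inf cofinite (principal (A \<S> X)))" for \<S>
  have F_not_bot: "F \<S> \<noteq> bot" for \<S>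
    unfolding F_def
  proof (rule INF_filter_not_bot)
    fix \<X> :: "nat set set"
    assume fin: "finite \<X>"
    have "inf cofinite (principal (\<Inter>X\<in>\<X>. A \<S> X)) \<le> (INF X\<in>\<X>. inf cofinite (principal (A \<S> X)))"
      by (intro INF_greatest inf_mono) auto
    moreover have "inf cofinite (principal (\<Inter>X\<in>\<X>. A \<S> X)) \<noteq> bot"
    proof
      assume "inf cofinite (principal (\<Inter>X\<in>\<X>. A \<S> X)) = bot"
      then have "finite (\<Inter>X\<in>\<X>. A \<S> X)"
        unfolding trivial_limit_def eventually_inf_principal eventually_cofinite by (simp add: INTER_eq)
      then show False
        using infinite_Int_independent_sets[OF fin, of \<S>] unfolding A_def by blast
    qed
    ultimately show "(INF X\<in>\<X>. inf cofinite (principal (A \<S> X))) \<noteq> bot"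
      by (metis bot_unique)
  qed
  have "\<forall>\<S>. \<exists>U. ultrafilter U \<and> U \<le> F \<S>"
    using ultrafilter_exists[OF F_not_bot] by blast
  then obtain \<Phi> where \<Phi>: "\<And>\<S>. ultrafilter (\<Phi> \<S>)" "\<And>\<S>. \<Phi> \<S> \<le> F \<S>"
    by metis
  have le: "\<Phi> \<S> \<le> cofinite" "\<Phi> \<S> \<le> principal (A \<S> X)" for \<S> X
    using \<Phi>(2)[of \<S>] unfolding F_def by (simp_all only: le_INF_iff le_inf_iff UNIV_I simp_thms)
  \<comment> \<open>Prescriptions disagreeing at \<open>X\<close> would put both
    \<open>independent_set X\<close> and its complement into the common ultrafilter.\<close>
  have sub: "\<S> \<subseteq> \<T>" if eq: "\<Phi> \<S> = \<Phi> \<T>" for \<S> \<T>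
  proof (rule ccontr)
    assume "\<not> \<S> \<subseteq> \<T>"
    then obtain X where "X \<in> \<S>" "X \<notin> \<T>"
      by blast
    then have "eventually (\<lambda>m. m \<in> independent_set X) (\<Phi> \<S>)"
      and "eventually (\<lambda>m. m \<notin> independent_set X) (\<Phi> \<S>)"
      using le(2)[of \<S> X] le(2)[of \<T> X] eq by (simp_all add: A_def le_principal)
    then have "eventually (\<lambda>m. False) (\<Phi> \<S>)"
      by eventually_elim simp
    then show False
      using \<Phi>(1) unfolding ultrafilter_def trivial_limit_def by blast
  qed
  then have "inj \<Phi>"
    by (intro injI subset_antisym) auto
  then show thesis
    using that \<Phi>(1) le(1) by blast
qed

section \<open>Balanced measures\<close>

text \<open>Continuity is automatic at the isolated points, so only the limit along \<open>F\<close>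
  at \<open>None\<close> matters.\<close>

lemma continuous_map_N_space_iff:
  "continuous_map (N_space F) euclideanreal f \<longleftrightarrow> ((\<lambda>n. f (Some n)) \<longlongrightarrow> f None) F"
  unfolding continuous_map tendsto_def by (auto simp: openin_N_space)

text \<open>Half the difference of the uniform probability measure on \<open>S\<close> and the point
  mass at \<open>None\<close>: total charge 0 and norm 1.\<close>

definition balanced_measure :: "nat set \<Rightarrow> nat option \<Rightarrow>\<^sub>0 real" where
  "balanced_measure S = Abs_poly_mapping (\<lambda>x. case x of None \<Rightarrow> - 1 / 2
     | Some i \<Rightarrow> if i \<in> S then 1 / (2 * real (card S)) else 0)"

context
  fixes S :: "nat set"
  assumes S: "finite S" "S \<noteq> {}"
begin

lemma lookup_balanced_measure:
  "Poly_Mapping.lookup (balanced_measure S) x = (case x of None \<Rightarrow> - 1 / 2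
     | Some i \<Rightarrow> if i \<in> S then 1 / (2 * real (card S)) else 0)"
proof -
  have "{x. (case x of None \<Rightarrow> - 1 / 2 | Some i \<Rightarrow> if i \<in> S then 1 / (2 * real (card S)) else 0) \<noteq> 0}
      \<subseteq> insert None (Some ` S)"
    (is "{x. ?g x \<noteq> 0} \<subseteq> _")
  proof
    show "x \<in> insert None (Some ` S)" if "x \<in> {x. ?g x \<noteq> 0}" for x
      using that by (cases x) (auto split: if_splits)
  qed
  then show ?thesis
    unfolding balanced_measure_def using S(1)
    by (subst lookup_Abs_poly_mapping) (auto intro: finite_subset)
qed

lemma keys_balanced_measure: "Poly_Mapping.keys (balanced_measure S) = insert None (Some ` S)"
proof (rule set_eqI)
  show "x \<in> Poly_Mapping.keys (balanced_measure S) \<longleftrightarrow> x \<in> insert None (Some ` S)" for x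
    using S by (cases x) (auto simp: in_keys_iff lookup_balanced_measure)
qed

lemma fs_norm_balanced_measure: "fs_norm (balanced_measure S) = 1"
  using S by (simp add: fs_norm_def keys_balanced_measure lookup_balanced_measure sum.reindex)

lemma fs_integral_balanced_measure:
  "fs_integral (balanced_measure S) f = (\<Sum>i\<in>S. f (Some i) - f None) / (2 * card S)"
  using S by (simp add: fs_integral_def keys_balanced_measure lookup_balanced_measure sum.reindex
      sum_subtractf diff_divide_distrib sum_divide_distrib)

end

lemma JNP_N_space_of_sequence:
  assumes "filterlim x F sequentially"
  shows "JNP (N_space F)"
proof -
  have "(\<lambda>n. fs_integral (balanced_measure {x n}) f) \<longlonglongrightarrow> 0"
    if "continuous_map (N_space F) euclideanreal f" for f
  proof -
    have "(\<lambda>n. f (Some (x n))) \<longlonglongrightarrow> f None"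
      using that assms unfolding continuous_map_N_space_iff by (rule filterlim_compose)
    then have "(\<lambda>n. (f (Some (x n)) - f None) / 2) \<longlonglongrightarrow> (f None - f None) / 2"
      by (intro tendsto_intros) simp_all
    then show ?thesis
      by (simp add: fs_integral_balanced_measure)
  qed
  then show ?thesis
    unfolding JNP_def fs_measure_on_def
    by (intro exI[of _ "\<lambda>n. balanced_measure {x n}"]) (simp add: fs_norm_balanced_measure)
qed

text \<open>Points of \<open>S n\<close> where \<open>f\<close> is close to \<open>f None\<close>
  contribute little; the remaining ones have vanishing proportion, and boundedness of
  \<open>f\<close> controls their contribution.\<close>

lemma BJNP_N_space_of_density:
  fixes S :: "nat \<Rightarrow> nat set"
  assumes S: "\<And>n. finite (S n)" "\<And>n. S n \<noteq> {}"
    and density: "\<And>P. eventually P F \<Longrightarrow> (\<lambda>n. card {i\<in>S n. \<not> P i} / card (S n)) \<longlonglongrightarrow> 0"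
  shows "BJNP (N_space F)"
proof -
  have "(\<lambda>n. fs_integral (balanced_measure (S n)) f) \<longlonglongrightarrow> 0"
    if cont: "continuous_map (N_space F) euclideanreal f" and bdd: "bounded (range f)" for f
  proof (rule LIMSEQ_I)
    fix e :: real assume "0 < e"
    obtain M where M: "0 < M" "\<And>x. \<bar>f x\<bar> \<le> M"
      using bdd unfolding bounded_pos by auto
    define P where "P i \<longleftrightarrow> \<bar>f (Some i) - f None\<bar> < e" for i
    define b where "b n = card {i\<in>S n. \<not> P i} / card (S n)" for n
    have "eventually P F"
      using cont \<open>0 < e\<close> unfolding continuous_map_N_space_iff tendsto_iff P_def dist_real_def
      by blast
    then have "b \<longlonglongrightarrow> 0"
      unfolding b_def by (rule density)
    moreover have "0 < e / (2 * M)"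
      using M(1) \<open>0 < e\<close> by simp
    \<comment> \<open>With this threshold the average deviation on \<open>S n\<close> is below 2e,
      and the factor 1/2 in the balanced measure brings it below e.\<close>
    ultimately obtain N where N: "\<And>n. n \<ge> N \<Longrightarrow> \<bar>b n\<bar> < e / (2 * M)"
      unfolding LIMSEQ_iff by (metis diff_zero real_norm_def)
    have "\<bar>fs_integral (balanced_measure (S n)) f\<bar> < e" if "n \<ge> N" for n
    proof -
      have card: "0 < card (S n)"
        using S by (simp add: card_gt_0_iff)
      have "\<bar>\<Sum>i\<in>S n. f (Some i) - f None\<bar> \<le> (\<Sum>i\<in>S n. e + (if P i then 0 else 2 * M))"
      proof (rule sum_abs[THEN order_trans], rule sum_mono)
        fix i
        show "\<bar>f (Some i) - f None\<bar> \<le> e + (if P i then 0 else 2 * M)"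
          using M(2)[of "Some i"] M(2)[of None] \<open>0 < e\<close> by (auto simp: P_def)
      qed
      also have "\<dots> = card (S n) * (e + b n * (2 * M))"
        using card S(1) by (simp add: sum.distrib sum.If_cases b_def field_simps Int_def)
      also have "\<dots> < card (S n) * (e + e)"
        using N[OF that] M(1) card by (intro mult_strict_left_mono) (auto simp: field_simps abs_less_iff)
      finally show ?thesis
        using card S by (simp add: fs_integral_balanced_measure abs_divide field_simps)
    qed
    then show "\<exists>N. \<forall>n\<ge>N. norm (fs_integral (balanced_measure (S n)) f - 0) < e"
      by auto
  qed
  then show ?thesis
    unfolding BJNP_def fs_measure_on_def
    by (intro exI[of _ "\<lambda>n. balanced_measure (S n)"]) (simp add: fs_norm_balanced_measure S)
qed

section \<open>Gliding humps\<close>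

text \<open>Both \<open>supp\<close> and \<open>mass\<close> ignore the point \<open>p\<^sub>F\<close>.\<close>

definition supp :: "(nat option \<Rightarrow>\<^sub>0 real) \<Rightarrow> nat set" where
  "supp \<mu> = {i. Some i \<in> Poly_Mapping.keys \<mu>}"

definition mass :: "(nat option \<Rightarrow>\<^sub>0 real) \<Rightarrow> nat set \<Rightarrow> real" where
  "mass \<mu> A = (\<Sum>i\<in>A. \<bar>Poly_Mapping.lookup \<mu> (Some i)\<bar>)"

lemma finite_supp: "finite (supp \<mu>)"
  unfolding supp_def using finite_vimageI[OF finite_keys, of Some] by (simp add: vimage_def)

lemma sum_keys_option:
  assumes "\<And>x. x \<notin> Poly_Mapping.keys \<mu> \<Longrightarrow> g x = 0"
  shows "(\<Sum>x\<in>Poly_Mapping.keys \<mu>. g x) = g None + (\<Sum>i\<in>supp \<mu>. g (Some i))"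
proof -
  have "x \<in> insert None (Some ` supp \<mu>)" if "x \<in> Poly_Mapping.keys \<mu>" for x
    using that by (cases x) (auto simp: supp_def)
  then have "(\<Sum>x\<in>Poly_Mapping.keys \<mu>. g x) = (\<Sum>x\<in>insert None (Some ` supp \<mu>). g x)"
    using assms finite_supp by (intro sum.mono_neutral_left) auto
  then show ?thesis
    using finite_supp by (simp add: sum.reindex)
qed

lemma fs_norm_eq: "fs_norm \<mu> = \<bar>Poly_Mapping.lookup \<mu> None\<bar> + mass \<mu> (supp \<mu>)"
  unfolding fs_norm_def mass_def by (rule sum_keys_option) (simp add: in_keys_iff)

lemma fs_integral_eq:
  "fs_integral \<mu> f = Poly_Mapping.lookup \<mu> None * f None
     + (\<Sum>i\<in>supp \<mu>. Poly_Mapping.lookup \<mu> (Some i) * f (Some i))"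
  unfolding fs_integral_def by (rule sum_keys_option) (simp add: in_keys_iff)

text \<open>Testing on indicators of isolated points makes the mass on \<open>K\<close> vanish.
  Testing on the constant 1 makes the coefficient at \<open>None\<close> nearly cancel the rest, so
  at least 3/8 of the norm lies off \<open>None\<close>, and 3/8 - 1/8 = 1/4.\<close>

lemma mass_outside_finite_set:
  fixes \<mu> :: "nat \<Rightarrow> nat option \<Rightarrow>\<^sub>0 real"
  assumes F: "F \<le> cofinite" and norm: "\<And>n. fs_norm (\<mu> n) = 1"
    and null: "\<forall>f. continuous_map (N_space F) euclideanreal f \<and> bounded (range f) \<longrightarrow>
      (\<lambda>n. fs_integral (\<mu> n) f) \<longlonglongrightarrow> 0"
    and K: "finite K"
  shows "eventually (\<lambda>n. mass (\<mu> n) K < 1 / 8 \<and> mass (\<mu> n) (supp (\<mu> n) - K) \<ge> 1 / 4) sequentially"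
proof -
  have "(\<lambda>n. Poly_Mapping.lookup (\<mu> n) (Some i)) \<longlonglongrightarrow> 0" for i
  proof -
    let ?f = "\<lambda>x. if x = Some i then 1 else 0 :: real"
    have "eventually (\<lambda>n. n \<noteq> i) F"
      using F by (rule filter_leD) (simp add: eventually_cofinite)
    then have "eventually (\<lambda>n. ?f (Some n) = ?f None) F"
      by (auto elim: eventually_mono)
    then have cont: "continuous_map (N_space F) euclideanreal ?f"
      unfolding continuous_map_N_space_iff by (rule tendsto_eventually)
    have "bounded (range ?f)"
      by (rule boundedI[of _ 1]) auto
    then have "(\<lambda>n. fs_integral (\<mu> n) ?f) \<longlonglongrightarrow> 0"
      using null cont by blast
    moreover have "fs_integral (\<mu> n) ?f = Poly_Mapping.lookup (\<mu> n) (Some i)" for n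
      by (simp add: fs_integral_def if_distrib[of "\<lambda>x. _ * x"] sum.delta in_keys_iff cong: if_cong)
    ultimately show ?thesis
      by simp
  qed
  then have "(\<lambda>n. mass (\<mu> n) K) \<longlonglongrightarrow> (\<Sum>i\<in>K. \<bar>0\<bar>)"
    unfolding mass_def by (intro tendsto_intros)
  then have "eventually (\<lambda>n. mass (\<mu> n) K < 1 / 8) sequentially"
    by (rule order_tendstoD) simp
  moreover have "eventually (\<lambda>n. \<bar>fs_integral (\<mu> n) (\<lambda>_. 1)\<bar> < 1 / 4) sequentially"
  proof (rule order_tendstoD)
    have "(\<lambda>n. fs_integral (\<mu> n) (\<lambda>_. 1)) \<longlonglongrightarrow> 0"
      using null by (simp add: continuous_map_N_space_iff)
    then show "(\<lambda>n. \<bar>fs_integral (\<mu> n) (\<lambda>_. 1)\<bar>) \<longlonglongrightarrow> 0"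
      by (rule tendsto_rabs_zero)
  qed simp
  ultimately show ?thesis
  proof eventually_elim
    case (elim n)
    let ?s = "\<Sum>i\<in>supp (\<mu> n). Poly_Mapping.lookup (\<mu> n) (Some i)"
    have "\<bar>?s\<bar> \<le> mass (\<mu> n) (supp (\<mu> n))"
      unfolding mass_def by (rule sum_abs)
    moreover have "fs_integral (\<mu> n) (\<lambda>_. 1) = Poly_Mapping.lookup (\<mu> n) None + ?s"
      by (simp add: fs_integral_eq)
    moreover have "\<bar>Poly_Mapping.lookup (\<mu> n) None\<bar> + mass (\<mu> n) (supp (\<mu> n)) = 1"
      using norm[of n] by (simp add: fs_norm_eq)
    ultimately have "mass (\<mu> n) (supp (\<mu> n)) \<ge> 3 / 8"
      using elim by linarith
    also have "mass (\<mu> n) (supp (\<mu> n)) \<le> mass (\<mu> n) (supp (\<mu> n) \<union> K)"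
      unfolding mass_def using finite_supp K by (intro sum_mono2) auto
    also have "\<dots> = mass (\<mu> n) (supp (\<mu> n) - K) + mass (\<mu> n) K"
      unfolding mass_def using finite_supp K
      by (subst sum.union_disjoint[symmetric]) auto
    finally show ?case
      using elim by simp
  qed
qed

lemma gliding_hump:
  fixes \<mu> :: "nat \<Rightarrow> nat option \<Rightarrow>\<^sub>0 real"
  assumes F: "F \<le> cofinite" and norm: "\<And>n. fs_norm (\<mu> n) = 1"
    and null: "\<forall>f. continuous_map (N_space F) euclideanreal f \<and> bounded (range f) \<longrightarrow>
      (\<lambda>n. fs_integral (\<mu> n) f) \<longlonglongrightarrow> 0"
  obtains r :: "nat \<Rightarrow> nat" and K :: "nat \<Rightarrow> nat set"
  where "mono K" "\<And>k. r k \<ge> k" "\<And>k. supp (\<mu> (r k)) \<subseteq> K (Suc k)" "\<And>k. finite (K k)"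
    "\<And>k. mass (\<mu> (r k)) (K k) < 1 / 8" "\<And>k. mass (\<mu> (r k)) (supp (\<mu> (r k)) - K k) \<ge> 1 / 4"
proof -
  define good where "good L k m \<longleftrightarrow> m \<ge> k \<and> mass (\<mu> m) L < 1 / 8 \<and> mass (\<mu> m) (supp (\<mu> m) - L) \<ge> 1 / 4"
    for L k m
  define pick where "pick L k = (SOME m. good L k m)" for L k
  have pick: "good L k (pick L k)" if "finite L" for L k
  proof -
    have "eventually (good L k) sequentially"
      using mass_outside_finite_set[OF F norm null that] eventually_ge_at_top[of k]
      unfolding good_def by eventually_elim auto
    then have "\<exists>m. good L k m"
      by (auto simp: eventually_sequentially)
    then show ?thesis
      unfolding pick_def by (rule someI_ex)
  qed
  \<comment> \<open>\<open>K k\<close> collects the supports of all measures chosen before stage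
    \<open>k\<close>, so the new humps \<open>supp (\<mu> (r k)) - K k\<close> are pairwise
    disjoint. The second argument of \<open>pick\<close> only forces
    \<open>r k \<ge> k\<close>.\<close>
  define K where "K = rec_nat {} (\<lambda>k L. L \<union> supp (\<mu> (pick L k)))"
  have K_simps: "K 0 = {}" "K (Suc k) = K k \<union> supp (\<mu> (pick (K k) k))" for k
    by (simp_all add: K_def)
  have finite_K: "finite (K k)" for k
    by (induction k) (auto simp: K_simps finite_supp)
  have "mono K"
    unfolding mono_iff_le_Suc by (auto simp: K_simps)
  then show thesis
    using pick[OF finite_K] finite_K by (intro that[of K "\<lambda>k. pick (K k) k"]) (auto simp: K_simps good_def)
qed

theorem not_BJNP_N_space_ultrafilter:
  assumes ultra: "ultrafilter F" and F: "F \<le> cofinite"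
  shows "\<not> BJNP (N_space F)"
proof
  assume "BJNP (N_space F)"
  then obtain \<mu> where norm: "\<And>n. fs_norm (\<mu> n) = 1"
    and null: "\<forall>f. continuous_map (N_space F) euclideanreal f \<and> bounded (range f) \<longrightarrow>
      (\<lambda>n. fs_integral (\<mu> n) f) \<longlonglongrightarrow> 0"
    unfolding BJNP_def topspace_N_space by blast
  obtain r K where mono: "mono K" and r: "\<And>k. r k \<ge> k" and supp: "\<And>k. supp (\<mu> (r k)) \<subseteq> K (Suc k)"
    and fin: "\<And>k. finite (K k)" and small: "\<And>k. mass (\<mu> (r k)) (K k) < 1 / 8"
    and large: "\<And>k. mass (\<mu> (r k)) (supp (\<mu> (r k)) - K k) \<ge> 1 / 4"
    by (rule gliding_hump[OF F norm null]) (rule that, assumption+)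
  define S where "S k = supp (\<mu> (r k)) - K k" for k
  have S_unique: "j = k" if "i \<in> S j" "i \<in> S k" for i j k
    using that supp monoD[OF mono, of "Suc j" k] monoD[OF mono, of "Suc k" j]
    unfolding S_def by (cases j k rule: linorder_cases) (auto simp: subset_iff)
  \<comment> \<open>\<open>b\<close> is the parity whose humps have their union outside the
    ultrafilter. If the union of the even humps belongs to \<open>F\<close>, disjointness excludes
    the odd ones.\<close>
  obtain b where b: "eventually (\<lambda>i. \<forall>k. even k = b \<longrightarrow> i \<notin> S k) F"
  proof (cases "eventually (\<lambda>i. \<forall>k. even k \<longrightarrow> i \<notin> S k) F")
    case True
    then show ?thesis
      by (intro that[of True]) simp
  next
    case False
    then have "eventually (\<lambda>i. \<not> (\<forall>k. even k \<longrightarrow> i \<notin> S k)) F"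
      using ultra unfolding ultrafilter_def by blast
    then have "eventually (\<lambda>i. \<forall>k. even k = False \<longrightarrow> i \<notin> S k) F"
      by (rule eventually_mono) (use S_unique in blast)
    then show ?thesis
      by (rule that)
  qed
  \<comment> \<open>The signs on the humps of parity \<open>b\<close>, and 0 elsewhere.
    \<open>THE\<close> is well defined there by disjointness, and \<open>f\<close> vanishes on a
    member of \<open>F\<close>, so it is continuous.\<close>
  define f where "f x = (case x of None \<Rightarrow> 0 | Some i \<Rightarrow>
      if \<exists>k. even k = b \<and> i \<in> S k then sgn (Poly_Mapping.lookup (\<mu> (r (THE k. i \<in> S k))) (Some i)) else 0)" for x
  have f_S: "f (Some i) = sgn (Poly_Mapping.lookup (\<mu> (r k)) (Some i))" if "even k = b" "i \<in> S k" for i k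
  proof -
    have "(THE k. i \<in> S k) = k"
      using that S_unique by blast
    then show ?thesis
      using that unfolding f_def by auto
  qed
  have f_le: "\<bar>f x\<bar> \<le> 1" for x
    by (simp add: f_def abs_sgn_eq split: option.split)
  have "eventually (\<lambda>i. f (Some i) = f None) F"
    using b by (rule eventually_mono) (auto simp: f_def)
  then have "continuous_map (N_space F) euclideanreal f"
    unfolding continuous_map_N_space_iff by (rule tendsto_eventually)
  moreover have "bounded (range f)"
    using f_le by (intro boundedI[of _ 1]) auto
  ultimately have "(\<lambda>n. fs_integral (\<mu> n) f) \<longlonglongrightarrow> 0"
    using null by blast
  then have "eventually (\<lambda>n. fs_integral (\<mu> n) f < 1 / 8) sequentially"
    by (rule order_tendstoD) simp
  then obtain N where N: "\<And>n. n \<ge> N \<Longrightarrow> fs_integral (\<mu> n) f < 1 / 8"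
    unfolding eventually_sequentially by blast
  define k where "k = (if b then 2 * N else 2 * N + 1)"
  have k: "even k = b" "k \<ge> N"
    by (auto simp: k_def)
  let ?l = "\<lambda>i. Poly_Mapping.lookup (\<mu> (r k)) (Some i)"
  have "fs_integral (\<mu> (r k)) f = (\<Sum>i\<in>supp (\<mu> (r k)). ?l i * f (Some i))"
    by (simp add: fs_integral_eq f_def)
  also have "\<dots> = (\<Sum>i\<in>supp (\<mu> (r k)) \<inter> K k. ?l i * f (Some i)) + (\<Sum>i\<in>S k. ?l i * f (Some i))"
    unfolding S_def using finite_supp by (rule sum.Int_Diff)
  also have "(\<Sum>i\<in>S k. ?l i * f (Some i)) = mass (\<mu> (r k)) (S k)"
    unfolding mass_def using f_S[OF k(1)] by (intro sum.cong) (simp_all add: linordered_idom_class.abs_sgn)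
  finally have "fs_integral (\<mu> (r k)) f
      = (\<Sum>i\<in>supp (\<mu> (r k)) \<inter> K k. ?l i * f (Some i)) + mass (\<mu> (r k)) (S k)" .
  moreover have "\<bar>\<Sum>i\<in>supp (\<mu> (r k)) \<inter> K k. ?l i * f (Some i)\<bar> \<le> mass (\<mu> (r k)) (K k)"
  proof -
    have "\<bar>\<Sum>i\<in>supp (\<mu> (r k)) \<inter> K k. ?l i * f (Some i)\<bar> \<le> (\<Sum>i\<in>supp (\<mu> (r k)) \<inter> K k. \<bar>?l i\<bar>)"
      using f_le by (intro sum_abs[THEN order_trans] sum_mono) (simp add: abs_mult mult_left_le)
    also have "\<dots> \<le> mass (\<mu> (r k)) (K k)"
      unfolding mass_def using fin by (intro sum_mono2) auto
    finally show ?thesis .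
  qed
  \<comment> \<open>The hump gives at least 1/4, the part of the support inside \<open>K k\<close>
    takes away less than 1/8, and \<open>f None = 0\<close> removes the atom at
    \<open>None\<close>.\<close>
  ultimately have "fs_integral (\<mu> (r k)) f \<ge> 1 / 8"
    using small[of k] large[of k] unfolding S_def by linarith
  then show False
    using N[of "r k"] r[of k] k(2) by simp
qed

text \<open>The dual ideal of \<open>F\<close> is tall.\<close>

definition tall :: "'a filter \<Rightarrow> bool" where
  "tall F \<longleftrightarrow> (\<forall>A. infinite A \<longrightarrow> (\<exists>B\<subseteq>A. infinite B \<and> eventually (\<lambda>x. x \<notin> B) F))"

theorem not_JNP_N_space_tall:
  assumes tall: "tall F" and F: "F \<le> cofinite"
  shows "\<not> JNP (N_space F)"
proof
  assume "JNP (N_space F)"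
  then obtain \<mu> where norm: "\<And>n. fs_norm (\<mu> n) = 1"
    and null: "\<forall>f. continuous_map (N_space F) euclideanreal f \<longrightarrow> (\<lambda>n. fs_integral (\<mu> n) f) \<longlonglongrightarrow> 0"
    unfolding JNP_def by blast
  have null_bounded: "\<forall>f. continuous_map (N_space F) euclideanreal f \<and> bounded (range f) \<longrightarrow>
      (\<lambda>n. fs_integral (\<mu> n) f) \<longlonglongrightarrow> 0"
    using null by blast
  obtain r K where mono: "mono K" and r: "\<And>k. r k \<ge> k" and supp: "\<And>k. supp (\<mu> (r k)) \<subseteq> K (Suc k)"
    and large: "\<And>k. mass (\<mu> (r k)) (supp (\<mu> (r k)) - K k) \<ge> 1 / 4"
    by (rule gliding_hump[OF F norm null_bounded]) (rule that, assumption+)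
  have "\<exists>i. i \<in> supp (\<mu> (r k)) \<and> i \<notin> K k" for k
  proof (rule ccontr)
    assume "\<nexists>i. i \<in> supp (\<mu> (r k)) \<and> i \<notin> K k"
    then have "supp (\<mu> (r k)) - K k = {}"
      by blast
    then show False
      using large[of k] by (metis mass_def not_one_le_zero sum.empty zero_less_divide_1_iff
          zero_less_numeral linorder_not_le)
  qed
  then obtain x where x: "\<And>k. x k \<in> supp (\<mu> (r k))" "\<And>k. x k \<notin> K k"
    by metis
  \<comment> \<open>This makes the matrix \<open>l\<close> below lower triangular: the measure at
    stage \<open>k\<close> does not see points chosen later.\<close>
  have x_later: "x j \<notin> supp (\<mu> (r k))" if "k < j" for j k
    using x(2)[of j] supp[of k] monoD[OF mono, of "Suc k" j] that by auto
  then have "inj x"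
    using x(1) by (intro injI) (metis linorder_neqE_nat)
  then obtain B where B: "B \<subseteq> range x" "infinite B" "eventually (\<lambda>i. i \<notin> B) F"
    using tall range_inj_infinite unfolding tall_def by blast
  define l where "l k j = Poly_Mapping.lookup (\<mu> (r k)) (Some (x j))" for k j
  have l_diag: "l k k \<noteq> 0" for k
    using x(1)[of k] by (simp add: l_def supp_def in_keys_iff)
  have l_later: "l k j = 0" if "k < j" for j k
    using x_later[OF that] by (simp add: l_def supp_def in_keys_iff)
  text \<open>The values \<open>c k = f (x k)\<close> solve the triangular system \<open>\<mu>\<^bsub>r k\<^esub>(f) = 1\<close>, where \<open>x k \<in> B\<close>.\<close>
  have "\<exists>c. \<forall>k. c k = (if x k \<in> B then (1 - (\<Sum>j<k. l k j * c j)) / l k k else 0)"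
    by (rule dependent_wf_choice[of less_than]) (auto intro!: sum.cong)
  then obtain c where c: "\<And>k. c k = (if x k \<in> B then (1 - (\<Sum>j<k. l k j * c j)) / l k k else 0)"
    by blast
  define f where "f y = (case y of None \<Rightarrow> 0 | Some i \<Rightarrow> if i \<in> range x then c (inv x i) else 0)" for y
  have f_x: "f (Some (x k)) = c k" for k
    by (simp add: f_def \<open>inj x\<close>)
  have f_zero: "f (Some i) = 0" if "i \<notin> B" for i
    using that c by (auto simp: f_def \<open>inj x\<close>)
  have "eventually (\<lambda>i. f (Some i) = f None) F"
    using B(3) by (rule eventually_mono) (simp add: f_zero, simp add: f_def)
  then have "continuous_map (N_space F) euclideanreal f"
    unfolding continuous_map_N_space_iff by (rule tendsto_eventually)
  then have "(\<lambda>n. fs_integral (\<mu> n) f) \<longlonglongrightarrow> 0"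
    using null by blast
  then have "eventually (\<lambda>n. fs_integral (\<mu> n) f < 1) sequentially"
    by (rule order_tendstoD) simp
  then obtain N where N: "\<And>n. n \<ge> N \<Longrightarrow> fs_integral (\<mu> n) f < 1"
    unfolding eventually_sequentially by blast
  \<comment> \<open>Infinitely many stages have their chosen point in \<open>B\<close>, so one with
    integral 1 occurs beyond \<open>N\<close>.\<close>
  have "infinite (x -` B)"
    using B(1,2) finite_imageI[of "x -` B" x] by (auto simp: image_vimage_eq Int_absorb2)
  then obtain k where k: "k \<ge> N" "x k \<in> B"
    by (metis infinite_nat_iff_unbounded_le vimageD)
  have "fs_integral (\<mu> (r k)) f = (\<Sum>i\<in>supp (\<mu> (r k)). Poly_Mapping.lookup (\<mu> (r k)) (Some i) * f (Some i))"
    by (simp add: fs_integral_eq f_def)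
  \<comment> \<open>Off \<open>range x\<close> the function is 0, and points \<open>x j\<close> with
    \<open>j > k\<close> are outside the support.\<close>
  also have "\<dots> = (\<Sum>i\<in>x ` {..k}. Poly_Mapping.lookup (\<mu> (r k)) (Some i) * f (Some i))"
  proof (rule sum.mono_neutral_cong)
    fix i assume i: "i \<in> supp (\<mu> (r k)) - x ` {..k}"
    have "i \<notin> range x"
      using i x_later[of k] by (metis DiffE atMost_iff image_eqI not_le rangeE)
    then show "Poly_Mapping.lookup (\<mu> (r k)) (Some i) * f (Some i) = 0"
      by (simp add: f_def)
  next
    fix i assume "i \<in> x ` {..k} - supp (\<mu> (r k))"
    then show "Poly_Mapping.lookup (\<mu> (r k)) (Some i) * f (Some i) = 0"
      by (simp add: supp_def in_keys_iff)
  qed (simp_all add: finite_supp)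
  also have "\<dots> = (\<Sum>j\<le>k. l k j * c j)"
    using \<open>inj x\<close> by (subst sum.reindex) (auto simp: inj_on_def f_x l_def)
  also have "\<dots> = (\<Sum>j<k. l k j * c j) + l k k * c k"
    by (simp add: lessThan_Suc_atMost[symmetric])
  also have "\<dots> = 1"
    using k(2) l_diag[of k] c[of k] by simp
  finally show False
    using N[of "r k"] r[of k] k(1) by simp
qed

section \<open>Density filters and interleavings\<close>

text \<open>Of two disjoint infinite halves of the given set, at least one has its complement in the
  ultrafilter.\<close>

lemma tall_ultrafilter:
  assumes "ultrafilter F"
  shows "tall F"
  unfolding tall_def
proof (intro allI impI)
  fix A :: "'a set"
  assume "infinite A"
  then obtain B C where BC: "B \<subseteq> A" "C \<subseteq> A" "infinite B" "infinite C" "B \<inter> C = {}"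
    by (rule infinite_split)
  show "\<exists>B\<subseteq>A. infinite B \<and> eventually (\<lambda>x. x \<notin> B) F"
  proof (cases "eventually (\<lambda>x. x \<notin> B) F")
    case True
    then show ?thesis
      using BC by blast
  next
    case False
    then have "eventually (\<lambda>x. \<not> x \<notin> B) F"
      using assms unfolding ultrafilter_def by blast
    then have "eventually (\<lambda>x. x \<notin> C) F"
      by (rule eventually_mono) (use BC in blast)
    then show ?thesis
      using BC by blast
  qed
qed

definition density_filter :: "(nat \<Rightarrow> 'a set) \<Rightarrow> 'a filter" where
  "density_filter S = Abs_filter (\<lambda>P. (\<lambda>n. card {i\<in>S n. \<not> P i} / card (S n)) \<longlonglongrightarrow> 0)"

context
  fixes S :: "nat \<Rightarrow> 'a set"
  assumes fin: "\<And>n. finite (S n)"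
begin

text \<open>Exceptional proportions are subadditive, which gives closure under intersection; finite
  blocks make them monotone.\<close>

lemma eventually_density_filter:
  "eventually P (density_filter S) \<longleftrightarrow> (\<lambda>n. card {i\<in>S n. \<not> P i} / card (S n)) \<longlonglongrightarrow> 0"
proof -
  have "is_filter (\<lambda>P. (\<lambda>n. card {i\<in>S n. \<not> P i} / card (S n)) \<longlonglongrightarrow> 0)"
  proof
    show "(\<lambda>n. card {i\<in>S n. \<not> True} / card (S n)) \<longlonglongrightarrow> 0"
      by simp
  next
    fix P Q
    assume "(\<lambda>n. card {i\<in>S n. \<not> P i} / card (S n)) \<longlonglongrightarrow> 0"
      and "(\<lambda>n. card {i\<in>S n. \<not> Q i} / card (S n)) \<longlonglongrightarrow> 0"
    then have lim: "(\<lambda>n. card {i\<in>S n. \<not> P i} / card (S n) + card {i\<in>S n. \<not> Q i} / card (S n)) \<longlonglongrightarrow> 0"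
      by (rule tendsto_add_zero)
    have "card {i\<in>S n. \<not> (P i \<and> Q i)} \<le> card {i\<in>S n. \<not> P i} + card {i\<in>S n. \<not> Q i}" for n
    proof -
      have "{i\<in>S n. \<not> (P i \<and> Q i)} = {i\<in>S n. \<not> P i} \<union> {i\<in>S n. \<not> Q i}"
        by blast
      then show ?thesis
        by (simp only: card_Un_le)
    qed
    then have "card {i\<in>S n. \<not> (P i \<and> Q i)} / card (S n)
        \<le> card {i\<in>S n. \<not> P i} / card (S n) + card {i\<in>S n. \<not> Q i} / card (S n)" for n
      unfolding add_divide_distrib[symmetric]
      by (intro divide_right_mono) (simp_all only: of_nat_add[symmetric] of_nat_le_iff of_nat_0_le_iff)
    then show "(\<lambda>n. card {i\<in>S n. \<not> (P i \<and> Q i)} / card (S n)) \<longlonglongrightarrow> 0"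
      by (intro tendsto_sandwich[OF _ _ tendsto_const lim]) simp_all
  next
    fix P Q :: "'a \<Rightarrow> bool"
    assume "\<forall>i. P i \<longrightarrow> Q i" and lim: "(\<lambda>n. card {i\<in>S n. \<not> P i} / card (S n)) \<longlonglongrightarrow> 0"
    then have "card {i\<in>S n. \<not> Q i} \<le> card {i\<in>S n. \<not> P i}" for n
      using fin by (intro card_mono) auto
    then show "(\<lambda>n. card {i\<in>S n. \<not> Q i} / card (S n)) \<longlonglongrightarrow> 0"
      by (intro tendsto_sandwich[OF _ _ tendsto_const lim]) (simp_all add: divide_right_mono)
  qed
  then show ?thesis
    unfolding density_filter_def by (rule eventually_Abs_filter)
qed

lemma density_filter_neq_bot:
  assumes "\<And>n. S n \<noteq> {}"
  shows "density_filter S \<noteq> bot"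
proof -
  have "card {i\<in>S n. \<not> False} / card (S n) = (1 :: real)" for n
    using assms fin by simp
  then have "\<not> (\<lambda>n. card {i\<in>S n. \<not> False} / card (S n)) \<longlonglongrightarrow> 0"
    by (simp only: LIMSEQ_const_iff)
  then show ?thesis
    unfolding trivial_limit_def eventually_density_filter .
qed

text \<open>A bounded count divided by block sizes tending to infinity vanishes. This serves both
  finite exceptional sets and sets with at most one point per block.\<close>

lemma eventually_density_filter_if_bounded:
  assumes "filterlim (\<lambda>n. card (S n)) at_top sequentially"
    and le: "\<And>n. card {i\<in>S n. \<not> P i} \<le> c"
  shows "eventually P (density_filter S)"
  unfolding eventually_density_filter
proof (rule tendsto_sandwich[OF _ _ tendsto_const])
  show "(\<lambda>n. c / card (S n)) \<longlonglongrightarrow> 0"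
    using assms(1)
    by (intro tendsto_divide_0[OF tendsto_const] filterlim_at_top_imp_at_infinity
        filterlim_compose[OF filterlim_real_sequentially])
qed (use le in \<open>simp_all add: divide_right_mono\<close>)

lemma density_filter_le_cofinite:
  assumes "filterlim (\<lambda>n. card (S n)) at_top sequentially"
  shows "density_filter S \<le> cofinite"
proof (rule filter_leI)
  fix P :: "'a \<Rightarrow> bool"
  assume "eventually P cofinite"
  then have "card {i\<in>S n. \<not> P i} \<le> card {i. \<not> P i}" for n
    unfolding eventually_cofinite by (intro card_mono) auto
  then show "eventually P (density_filter S)"
    by (rule eventually_density_filter_if_bounded[OF assms])
qed

end

text \<open>The blocks are the finite fibres of \<open>g\<close>, so an infinite set meets
  infinitely many of them; one point from each fibre it meets forms the required subset.\<close>

lemma tall_density_filter_vimage: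
  fixes g :: "'a \<Rightarrow> nat"
  assumes fin: "\<And>n. finite (g -` {n})"
    and lim: "filterlim (\<lambda>n. card (g -` {n})) at_top sequentially"
  shows "tall (density_filter (\<lambda>n. g -` {n}))"
  unfolding tall_def
proof (intro allI impI)
  fix A :: "'a set"
  assume "infinite A"
  then have "infinite (g ` A)"
    using fin inf_img_fin_dom by metis
  obtain B where B: "B \<subseteq> A" "inj_on g B" "g ` A = g ` B"
    using subset_image_inj[of "g ` A" g A] by auto
  have "infinite B"
    using \<open>infinite (g ` A)\<close> B(3) by auto
  moreover have "card {i \<in> g -` {n}. \<not> i \<notin> B} \<le> 1" for n
  proof -
    have "finite {i \<in> g -` {n}. \<not> i \<notin> B}"
      by (rule finite_subset[OF _ fin[of n]]) blast
    then show ?thesis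
      using B(2) by (auto simp: card_le_Suc0_iff_eq inj_on_def)
  qed
  then have "eventually (\<lambda>i. i \<notin> B) (density_filter (\<lambda>n. g -` {n}))"
    by (rule eventually_density_filter_if_bounded[OF fin lim])
  ultimately show "\<exists>B\<subseteq>A. infinite B \<and> eventually (\<lambda>i. i \<notin> B) (density_filter (\<lambda>n. g -` {n}))"
    using B(1) by blast
qed

text \<open>The antidiagonals of the pairing function partition the naturals into blocks of size
  \<open>n + 1\<close>; the preimage form fits \<open>tall_density_filter_vimage\<close>.\<close>

definition diagonal :: "nat \<Rightarrow> nat set" where
  "diagonal n = (\<lambda>i. fst (prod_decode i) + snd (prod_decode i)) -` {n}"

lemma diagonal_eq: "diagonal n = (\<lambda>a. prod_encode (a, n - a)) ` {..n}"
proof (rule set_eqI)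
  fix i
  obtain a b where i: "i = prod_encode (a, b)"
    by (metis prod_decode_inverse surj_pair)
  then show "i \<in> diagonal n \<longleftrightarrow> i \<in> (\<lambda>a. prod_encode (a, n - a)) ` {..n}"
    by (auto simp: diagonal_def intro!: image_eqI[of _ _ a])
qed

lemma finite_diagonal: "finite (diagonal n)"
  by (simp add: diagonal_eq)

lemma card_diagonal: "card (diagonal n) = Suc n"
  unfolding diagonal_eq by (subst card_image) (auto simp: inj_on_def)

lemma diagonal_neq_empty: "diagonal n \<noteq> {}"
  using card_diagonal[of n] by auto

lemma card_diagonal_at_top: "filterlim (\<lambda>n. card (diagonal n)) at_top sequentially"
  by (simp add: card_diagonal filterlim_Suc)

lemma tall_density_filter_diagonal: "tall (density_filter diagonal)"
  unfolding diagonal_def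
  by (rule tall_density_filter_vimage)
    (use finite_diagonal card_diagonal_at_top in \<open>simp_all add: diagonal_def\<close>)

text \<open>\<open>sup\<close> intersects the families of member sets, so this is the sum of the two
  filters on the evens and the odds.\<close>

definition interleave :: "nat filter \<Rightarrow> nat filter \<Rightarrow> nat filter" where
  "interleave G H = sup (filtermap (\<lambda>n. 2 * n) G) (filtermap (\<lambda>n. 2 * n + 1) H)"

lemma eventually_interleave:
  "eventually P (interleave G H) \<longleftrightarrow>
     eventually (\<lambda>n. P (2 * n)) G \<and> eventually (\<lambda>n. P (2 * n + 1)) H"
  by (simp add: interleave_def eventually_sup eventually_filtermap)

text \<open>The second filter is recovered from its trace on the odd numbers, where the condition on
  the evens is made vacuous.\<close>

lemma inj_interleave: "inj (interleave G)"
proof (rule injI)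
  fix H H' assume eq: "interleave G H = interleave G H'"
  have "eventually P H \<longleftrightarrow> eventually P H'" for P
  proof -
    have "eventually P K \<longleftrightarrow> eventually (\<lambda>n. odd n \<longrightarrow> P (n div 2)) (interleave G K)" for K
      by (simp add: eventually_interleave)
    then show ?thesis
      using eq by simp
  qed
  then show "H = H'"
    by (simp add: filter_eq_iff)
qed

lemma interleave_neq_bot: "H \<noteq> bot \<Longrightarrow> interleave G H \<noteq> bot"
  unfolding trivial_limit_def eventually_interleave by simp

lemma interleave_le_cofinite:
  assumes "G \<le> cofinite" "H \<le> cofinite"
  shows "interleave G H \<le> cofinite"
proof (rule filter_leI)
  fix P :: "nat \<Rightarrow> bool"
  assume "eventually P cofinite"
  then have "finite {n. \<not> P n}"
    by (simp add: eventually_cofinite)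
  then have "finite ((\<lambda>n. 2 * n) -` {n. \<not> P n})" "finite ((\<lambda>n. 2 * n + 1) -` {n. \<not> P n})"
    by (auto intro!: finite_vimageI simp: inj_def simp del: vimage_Collect_eq)
  then have "eventually (\<lambda>n. P (2 * n)) cofinite" "eventually (\<lambda>n. P (2 * n + 1)) cofinite"
    by (simp_all add: eventually_cofinite vimage_def)
  then show "eventually P (interleave G H)"
    using assms by (auto simp: eventually_interleave dest: filter_leD)
qed

text \<open>An infinite set has an infinite even or odd part. Tallness is applied in that half, and
  the image of the subset misses the other half.\<close>

lemma tall_interleave:
  assumes "tall G" "tall H"
  shows "tall (interleave G H)"
  unfolding tall_def
proof (intro allI impI)
  fix A :: "nat set"
  assume "infinite A"
  have image: "\<exists>B\<subseteq>A. infinite B \<and> eventually (\<lambda>x. x \<notin> B) (interleave G H)"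
    if h: "inj h" "B \<subseteq> h -` A" "infinite B" "eventually (\<lambda>x. x \<notin> h ` B) (interleave G H)"
    for h :: "nat \<Rightarrow> nat" and B
    using that by (intro exI[of _ "h ` B"]) (auto dest: finite_imageD intro: inj_on_subset)
  have even: "eventually (\<lambda>x. x \<notin> (\<lambda>n. 2 * n) ` B) (interleave G H)"
    if "eventually (\<lambda>x. x \<notin> B) G" for B :: "nat set"
  proof -
    have "2 * n \<in> (\<lambda>n. 2 * n) ` B \<longleftrightarrow> n \<in> B" "2 * n + 1 \<notin> (\<lambda>n. 2 * n) ` B" for n
      by (auto simp: image_iff, presburger)
    then show ?thesis
      using that by (simp only: eventually_interleave not_False_eq_True eventually_True simp_thms)
  qed
  have odd: "eventually (\<lambda>x. x \<notin> (\<lambda>n. 2 * n + 1) ` B) (interleave G H)"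
    if "eventually (\<lambda>x. x \<notin> B) H" for B :: "nat set"
  proof -
    have "2 * n + 1 \<in> (\<lambda>n. 2 * n + 1) ` B \<longleftrightarrow> n \<in> B" "2 * n \<notin> (\<lambda>n. 2 * n + 1) ` B" for n
      by (auto simp: image_iff, presburger)
    then show ?thesis
      using that by (simp only: eventually_interleave not_False_eq_True eventually_True simp_thms)
  qed
  have "A = (\<lambda>n. 2 * n) ` ((\<lambda>n. 2 * n) -` A) \<union> (\<lambda>n. 2 * n + 1) ` ((\<lambda>n. 2 * n + 1) -` A)"
    by (auto simp: image_iff elim: oddE evenE) presburger
  then consider "infinite ((\<lambda>n. 2 * n) -` A)" | "infinite ((\<lambda>n. 2 * n + 1) -` A)"
    using \<open>infinite A\<close> by (metis finite_Un finite_imageI)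
  then show "\<exists>B\<subseteq>A. infinite B \<and> eventually (\<lambda>x. x \<notin> B) (interleave G H)"
  proof cases
    case 1
    then obtain B where "B \<subseteq> (\<lambda>n. 2 * n) -` A" "infinite B" "eventually (\<lambda>x. x \<notin> B) G"
      using assms(1) unfolding tall_def by blast
    then show ?thesis
      by (intro image[of "\<lambda>n. 2 * n" B] even) (simp_all add: inj_def)
  next
    case 2
    then obtain B where "B \<subseteq> (\<lambda>n. 2 * n + 1) -` A" "infinite B" "eventually (\<lambda>x. x \<notin> B) H"
      using assms(2) unfolding tall_def by blast
    then show ?thesis
      by (intro image[of "\<lambda>n. 2 * n + 1" B] odd) (simp_all add: inj_def)
  qed
qed

lemma JNP_N_space_interleave_cofinite: "JNP (N_space (interleave cofinite H))"
proof (rule JNP_N_space_of_sequence)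
  show "filterlim (\<lambda>n. 2 * n) (interleave cofinite H) sequentially"
    unfolding filterlim_def interleave_def cofinite_eq_sequentially by simp
qed

text \<open>Doubling moves the blocks to the even numbers and preserves all proportions, so the odd
  half never enters the measures.\<close>

lemma BJNP_N_space_interleave_density:
  assumes S: "\<And>n. finite (S n)" "\<And>n. S n \<noteq> {}"
  shows "BJNP (N_space (interleave (density_filter S) H))"
proof (rule BJNP_N_space_of_density)
  fix P
  assume "eventually P (interleave (density_filter S) H)"
  then have "(\<lambda>n. card {i\<in>S n. \<not> P (2 * i)} / card (S n)) \<longlonglongrightarrow> 0"
    by (simp add: eventually_interleave eventually_density_filter[of S, OF S(1)])
  moreover have "card {i \<in> (\<lambda>n. 2 * n) ` A. \<not> P i} = card {i\<in>A. \<not> P (2 * i)}"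
    "card ((\<lambda>n. 2 * n) ` A) = card A" for A :: "nat set"
  proof -
    have "{i \<in> (\<lambda>n. 2 * n) ` A. \<not> P i} = (\<lambda>n. 2 * n) ` {i\<in>A. \<not> P (2 * i)}"
      by blast
    then show "card {i \<in> (\<lambda>n. 2 * n) ` A. \<not> P i} = card {i\<in>A. \<not> P (2 * i)}"
      "card ((\<lambda>n. 2 * n) ` A) = card A"
      by (simp_all add: card_image inj_on_def)
  qed
  ultimately show "(\<lambda>n. card {i \<in> (\<lambda>n. 2 * n) ` S n. \<not> P i} / card ((\<lambda>n. 2 * n) ` S n)) \<longlonglongrightarrow> 0"
    by simp
qed (use S in simp_all)

section \<open>Assembly of the three families\<close>

theorem corollary1p2:
  "\<exists>\<F>\<^sub>3 \<F>\<^sub>4 \<F>\<^sub>5 :: nat filter set.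
     (\<forall>\<F> \<in> {\<F>\<^sub>3, \<F>\<^sub>4, \<F>\<^sub>5}.
        eqpoll \<F> (UNIV :: real set set) \<and>
        (\<forall>F\<in>\<F>. free_filter F) \<and>
        pairwise (\<lambda>F G. \<not> filter_isomorphic F G) \<F>) \<and>
     (\<forall>F\<in>\<F>\<^sub>3. JNP (N_space F)) \<and>
     (\<forall>F\<in>\<F>\<^sub>4. BJNP (N_space F) \<and> \<not> JNP (N_space F)) \<and>
     (\<forall>F\<in>\<F>\<^sub>5. \<not> BJNP (N_space F))"
proof -
  obtain \<Phi> :: "nat set set \<Rightarrow> nat filter" where \<Phi>: "inj \<Phi>"
    and ultra: "\<And>\<S>. ultrafilter (\<Phi> \<S>)" and cofin: "\<And>\<S>. \<Phi> \<S> \<le> cofinite"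
    by (rule ex_inj_free_ultrafilters) (rule that)
  \<comment> \<open>Preimages under \<open>h\<close> reindex the ultrafilters by sets of reals, the
    index type of the counting lemma.\<close>
  obtain h :: "nat set \<Rightarrow> real" where h: "bij h"
    using nat_sets_eqpoll_reals unfolding eqpoll_def by blast
  have inj_vimage: "inj (vimage h)"
    using h by (metis bij_is_surj inj_def surj_image_vimage_eq)
  \<comment> \<open>\<open>\<Psi>\<close> will be interleaving with a fixed filter or the identity;
    its injectivity keeps the number of filters at that of the ultrafilters.\<close>
  have family: "\<exists>R. R \<subseteq> range (\<lambda>\<S>. \<Psi> (\<Phi> \<S>)) \<and> eqpoll R (UNIV :: real set set) \<and>
      (\<forall>F\<in>R. free_filter F) \<and> pairwise (\<lambda>F G. \<not> filter_isomorphic F G) R"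
    if \<Psi>: "inj \<Psi>" and free: "\<And>\<S>. free_filter (\<Psi> (\<Phi> \<S>))" for \<Psi>
  proof -
    have "inj (\<lambda>A. \<Psi> (\<Phi> (h -` A)))"
      using inj_compose[OF \<Psi> inj_compose[OF \<Phi> inj_vimage]] by (simp add: comp_def)
    then obtain R where "R \<subseteq> range (\<lambda>A. \<Psi> (\<Phi> (h -` A)))" "eqpoll R (UNIV :: real set set)"
      "pairwise (\<lambda>F G. \<not> filter_isomorphic F G) R"
      by (rule eqpoll_many_nonisomorphic)
    then show ?thesis
      using free by (intro exI[of _ R]) blast
  qed
  have not_bot: "\<Phi> \<S> \<noteq> bot" for \<S>
    using ultra unfolding ultrafilter_def by blast
  have free: "free_filter (\<Phi> \<S>)" for \<S>
    using not_bot cofin by (simp add: free_filter_iff_le_cofinite)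
  have free_interleave: "free_filter (interleave G (\<Phi> \<S>))" if "G \<le> cofinite" for G \<S>
    using that not_bot cofin by (simp add: free_filter_iff_le_cofinite interleave_neq_bot interleave_le_cofinite)
  let ?D = "density_filter diagonal"
  have D: "?D \<le> cofinite"
    by (rule density_filter_le_cofinite[OF finite_diagonal card_diagonal_at_top])
  obtain R3 where R3: "R3 \<subseteq> range (\<lambda>\<S>. interleave cofinite (\<Phi> \<S>))" "eqpoll R3 (UNIV :: real set set)"
    "\<forall>F\<in>R3. free_filter F" "pairwise (\<lambda>F G. \<not> filter_isomorphic F G) R3"
    using family[OF inj_interleave free_interleave[OF order_refl]] by blast
  obtain R4 where R4: "R4 \<subseteq> range (\<lambda>\<S>. interleave ?D (\<Phi> \<S>))" "eqpoll R4 (UNIV :: real set set)"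
    "\<forall>F\<in>R4. free_filter F" "pairwise (\<lambda>F G. \<not> filter_isomorphic F G) R4"
    using family[OF inj_interleave free_interleave[OF D]] by blast
  obtain R5 where R5: "R5 \<subseteq> range \<Phi>" "eqpoll R5 (UNIV :: real set set)"
    "\<forall>F\<in>R5. free_filter F" "pairwise (\<lambda>F G. \<not> filter_isomorphic F G) R5"
    using family[of "\<lambda>F. F"] free by auto
  have "\<forall>F\<in>R3. JNP (N_space F)"
    using R3(1) JNP_N_space_interleave_cofinite by blast
  moreover have "\<forall>F\<in>R4. BJNP (N_space F) \<and> \<not> JNP (N_space F)"
  proof
    fix F assume "F \<in> R4"
    then obtain \<S> where F: "F = interleave ?D (\<Phi> \<S>)"
      using R4(1) by blast
    have "tall F"
      unfolding F by (intro tall_interleave tall_density_filter_diagonal tall_ultrafilter ultra)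
    moreover have "F \<le> cofinite"
      unfolding F by (intro interleave_le_cofinite D cofin)
    ultimately show "BJNP (N_space F) \<and> \<not> JNP (N_space F)"
      using BJNP_N_space_interleave_density[of diagonal, OF finite_diagonal diagonal_neq_empty] not_JNP_N_space_tall
      unfolding F by blast
  qed
  moreover have "\<forall>F\<in>R5. \<not> BJNP (N_space F)"
    using R5(1) not_BJNP_N_space_ultrafilter[OF ultra cofin] by blast
  ultimately show ?thesis
    using R3(2-4) R4(2-4) R5(2-4) by (intro exI[of _ R3] exI[of _ R4] exI[of _ R5]) simp
qed

end
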